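(* For every constant $\alpha>\log 2$ there exist constants $\gamma_\alpha,M_\alpha>0$, depending only on $\alpha$, with the following property. For every integer $k\ge 2$ and every integer $m\ge 2(1+\alpha k)$, there exist integers $n,d\ge 1$ with $n+d=m$ and a convex body $C\subset\mathbb{R}^{n+d}$ such that its projection $K:=\operatorname{proj}_{\mathbb{R}^n}(C)$ contains a translate of $k\,\mathbb{B}_\infty^n$ and, writing $S:=C\cap(\mathbb{Z}^n\times\mathbb{R}^d)$, $$\sup_{y\in S}\frac{h_S(y)}{\mathcal{H}_d(S)}\ \le\ M_\alpha\exp\Bigl(-\gamma_\alpha\,\frac{m}{k}\Bigr).$$
   Context: $\log$ is the natural logarithm. A convex body is a compact convex set with nonempty interior. Points of $\mathbb{R}^{n+d}=\mathbb{R}^n\times\mathbb{R}^d$ are written $(z,x)$, and $\operatorname{proj}_{\mathbb{R}^n}(z,x)=z$; the projection of a set is its image. $\mathbb{B}_\infty^n=\{u\in\mathbb{R}^n:\|u\|_\infty\le 1\}$. For a measurable set $A\subseteq\mathbb{Z}^n\times\mathbb{R}^d$, the mixed-integer volume is $\mathcal{H}_d(A)=\sum_{z\in\mathbb{Z}^n}\operatorname{vol}_d(A_z)$, where $A_z=\{x\in\mathbb{R}^d:(z,x)\in A\}$ and $\operatorname{vol}_d$ is $d$-dimensional Lebesgue measure. A closed halfspace in $\mathbb{R}^{n+d}$ is a set $\{y: a^{\mathsf T}y\ge c\}$ with $a\ne 0$, $c\in\mathbb{R}$. For $y\in S$ the halfspace depth is $h_S(y)=\inf\{\mathcal{H}_d(S\cap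 H): H\subset\mathbb{R}^{n+d}\text{ a closed halfspace with }y\in H\}$. *)

theory Defs
  imports "HOL-Analysis.Analysis"
begin

text \<open>
  The dimensions are quantified inside the theorem, so they cannot be types. A vector of
  \<open>\<real>\<^sup>N\<close> is a function in \<open>extensional {..<N}\<close>; this is the carrier of both the library
  topology \<open>powertop_real {..<N}\<close> and the library product measure over \<open>{..<N}\<close>.
  Points of \<open>\<real>\<^sup>n \<times> \<real>\<^sup>d\<close> are pairs, so the projection to \<open>\<real>\<^sup>n\<close> is \<open>fst\<close>.
\<close>

type_synonym rvec = "nat \<Rightarrow> real"

definition Rn :: "nat \<Rightarrow> rvec set" where
  "Rn N = (\<Pi>\<^sub>E i\<in>{..<N}. UNIV)"

definition Zn :: "nat \<Rightarrow> rvec set" where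
  "Zn N = (\<Pi>\<^sub>E i\<in>{..<N}. \<int>)"

definition vadd :: "nat \<Rightarrow> rvec \<Rightarrow> rvec \<Rightarrow> rvec" where
  "vadd N u v = (\<lambda>i\<in>{..<N}. u i + v i)"

definition vscale :: "nat \<Rightarrow> real \<Rightarrow> rvec \<Rightarrow> rvec" where
  "vscale N c v = (\<lambda>i\<in>{..<N}. c * v i)"

definition vdot :: "nat \<Rightarrow> rvec \<Rightarrow> rvec \<Rightarrow> real" where
  "vdot N u v = (\<Sum>i<N. u i * v i)"

text \<open>Only meaningful for \<open>N \<ge> 1\<close>, since \<open>Max {}\<close> is unspecified.\<close>

definition linf_norm :: "nat \<Rightarrow> rvec \<Rightarrow> real" where
  "linf_norm N u = Max ((\<lambda>i. \<bar>u i\<bar>) ` {..<N})"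

definition Binf :: "nat \<Rightarrow> rvec set" where
  "Binf N = {u \<in> Rn N. linf_norm N u \<le> 1}"

definition prod_top :: "nat \<Rightarrow> nat \<Rightarrow> (rvec \<times> rvec) topology" where
  "prod_top n d = prod_topology (powertop_real {..<n}) (powertop_real {..<d})"

definition convex_in :: "nat \<Rightarrow> nat \<Rightarrow> (rvec \<times> rvec) set \<Rightarrow> bool" where
  "convex_in n d C \<longleftrightarrow>
     (\<forall>(z, x)\<in>C. \<forall>(z', x')\<in>C. \<forall>u\<ge>0. \<forall>v\<ge>0. u + v = 1 \<longrightarrow>
        (vadd n (vscale n u z) (vscale n v z'), vadd d (vscale d u x) (vscale d v x')) \<in> C)"

definition convex_body :: "nat \<Rightarrow> nat \<Rightarrow> (rvec \<times> rvec) set \<Rightarrow> bool" where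
  "convex_body n d C \<longleftrightarrow>
     compactin (prod_top n d) C \<and> convex_in n d C \<and> prod_top n d interior_of C \<noteq> {}"

definition closed_halfspace :: "nat \<Rightarrow> nat \<Rightarrow> (rvec \<times> rvec) set \<Rightarrow> bool" where
  "closed_halfspace n d H \<longleftrightarrow>
     (\<exists>a\<in>Rn n. \<exists>b\<in>Rn d. \<exists>c. ((\<exists>i<n. a i \<noteq> 0) \<or> (\<exists>j<d. b j \<noteq> 0)) \<and>
        H = {(z, x). z \<in> Rn n \<and> x \<in> Rn d \<and> vdot n a z + vdot d b x \<ge> c})"

definition vol :: "nat \<Rightarrow> rvec set \<Rightarrow> ennreal" where
  "vol d A = emeasure (completion (\<Pi>\<^sub>M j\<in>{..<d}. lborel)) A"

definition mi_volume :: "nat \<Rightarrow> nat \<Rightarrow> (rvec \<times> rvec) set \<Rightarrow> ennreal" where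
  "mi_volume n d A = (\<Sum>\<^sub>\<infinity>z\<in>Zn n. vol d {x \<in> Rn d. (z, x) \<in> A})"

definition halfspace_depth ::
    "nat \<Rightarrow> nat \<Rightarrow> (rvec \<times> rvec) set \<Rightarrow> rvec \<times> rvec \<Rightarrow> ennreal" where
  "halfspace_depth n d S y =
     (INF H\<in>{H. closed_halfspace n d H \<and> y \<in> H}. mi_volume n d (S \<inter> H))"

end

theory Submission
  imports Defs
begin

text \<open>
  Let \<open>C\<close> be the cone \<open>\<parallel>z - c\<parallel>\<^sub>\<infinity> / k + \<parallel>x\<parallel>\<^sub>\<infinity> \<le> 1\<close> with \<open>c = (1/2, \<dots>, 1/2)\<close>, and choose \<open>n\<close> maximal
  with \<open>d = m - n \<ge> \<alpha> k n\<close>. The fibre over a lattice point at distance \<open>j + 1/2\<close> from \<open>c\<close> is a cube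
  whose volume is at most \<open>exp (- j d / k) \<le> exp (- \<alpha> j n)\<close> times that of a fibre over \<open>{0,1}\<^sup>n\<close>.
  There are at most \<open>(2 j + 2)\<^sup>n\<close> such points, so since \<open>2 exp (- \<alpha>) < 1\<close> nearly all of the
  mixed-integer volume is spread evenly over the \<open>2\<^sup>n\<close> points of \<open>{0,1}\<^sup>n\<close>. Every lattice point lies in
  a halfspace that contains no other vertex of this cube, hence has depth exponentially small
  in \<open>n\<close>, and \<open>n\<close> is proportional to \<open>m / k\<close>.
\<close>

section \<open>Volumes of axis-parallel cubes\<close>

lemma vol_cube:
  assumes "0 \<le> r"
  shows "vol d (\<Pi>\<^sub>E j\<in>{..<d}. {-r..r}) = ennreal ((2 * r) ^ d)"
proof -
  interpret product_sigma_finite "\<lambda>_::nat. lborel :: real measure" ..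
  let ?B = "\<Pi>\<^sub>E j\<in>{..<d}. {-r..r}"
  have "?B \<in> sets (\<Pi>\<^sub>M j\<in>{..<d}. lborel)"
    by (intro sets_PiM_I_finite) auto
  then have "vol d ?B = emeasure (\<Pi>\<^sub>M j\<in>{..<d}. lborel) ?B"
    by (simp add: vol_def emeasure_completion)
  also have "\<dots> = (\<Prod>j<d. emeasure lborel {-r..r})"
    by (intro emeasure_PiM) auto
  also have "\<dots> = ennreal ((2 * r) ^ d)"
    using assms by (simp add: ennreal_power)
  finally show ?thesis .
qed

text \<open>Monotonicity of \<open>emeasure\<close> rests on the measurability of the cube; a
  nonmeasurable \<open>A\<close> has \<open>emeasure\<close> 0. The bound thus applies directly to
  slices cut by a halfspace.\<close>

lemma vol_le_cube:
  assumes "0 \<le> r" "A \<subseteq> (\<Pi>\<^sub>E j\<in>{..<d}. {-r..r})"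
  shows "vol d A \<le> ennreal ((2 * r) ^ d)"
proof -
  have "(\<Pi>\<^sub>E j\<in>{..<d}. {-r..r}) \<in> sets (completion (\<Pi>\<^sub>M j\<in>{..<d}. lborel))"
    by (intro sets_completionI_sets sets_PiM_I_finite) auto
  then have "vol d A \<le> vol d (\<Pi>\<^sub>E j\<in>{..<d}. {-r..r})"
    unfolding vol_def using assms(2) by (intro emeasure_mono)
  then show ?thesis
    using assms(1) by (simp add: vol_cube)
qed

section \<open>The cone as a convex body\<close>

text \<open>A sum of two maxima over independent indices is the maximum over all pairs, so for
  positive \<open>n\<close>, \<open>d\<close> and \<open>k\<close> the pairwise inequalities encode
  the norm inequality, multiplied through by \<open>k\<close>.\<close>

definition cube_cone :: "nat \<Rightarrow> nat \<Rightarrow> nat \<Rightarrow> (rvec \<times> rvec) set" where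
  "cube_cone k n d =
     {(z, x). z \<in> Rn n \<and> x \<in> Rn d \<and> (\<forall>i<n. \<forall>j<d. \<bar>z i - 1/2\<bar> + real k * \<bar>x j\<bar> \<le> real k)}"

text \<open>Each constraint is a sublevel set of a convex function of the two coordinates
  \<open>z i\<close> and \<open>x j\<close>; \<open>ineq\<close> is that planar statement.\<close>

lemma cube_cone_convex: "convex_in n d (cube_cone k n d)"
proof -
  have ineq: "\<bar>u * a + v * a' - 1/2\<bar> + real k * \<bar>u * b + v * b'\<bar> \<le> real k"
    if "0 \<le> u" "0 \<le> v" "u + v = 1"
       "\<bar>a - 1/2\<bar> + real k * \<bar>b\<bar> \<le> real k" "\<bar>a' - 1/2\<bar> + real k * \<bar>b'\<bar> \<le> real k"
    for u v a a' b b' :: real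
  proof -
    have "u * a + v * a' - 1/2 = u * (a - 1/2) + v * (a' - 1/2)"
      using that(3) by (simp add: algebra_simps add_divide_distrib[symmetric])
    then have 1: "\<bar>u * a + v * a' - 1/2\<bar> \<le> u * \<bar>a - 1/2\<bar> + v * \<bar>a' - 1/2\<bar>"
      using that(1,2) abs_triangle_ineq[of "u * (a - 1/2)" "v * (a' - 1/2)"]
      by (simp only: abs_mult abs_of_nonneg)
    have "\<bar>u * b + v * b'\<bar> \<le> u * \<bar>b\<bar> + v * \<bar>b'\<bar>"
      using that(1,2) abs_triangle_ineq[of "u * b" "v * b'"]
      by (simp only: abs_mult abs_of_nonneg)
    then have 2: "real k * \<bar>u * b + v * b'\<bar> \<le> real k * (u * \<bar>b\<bar> + v * \<bar>b'\<bar>)"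
      by (intro mult_left_mono) auto
    have "u * (\<bar>a - 1/2\<bar> + real k * \<bar>b\<bar>) + v * (\<bar>a' - 1/2\<bar> + real k * \<bar>b'\<bar>) \<le> u * real k + v * real k"
      using that by (intro add_mono mult_left_mono) auto
    also have "\<dots> = real k"
      using that(3) by (simp add: distrib_right[symmetric])
    finally show ?thesis
      using 1 2 by (simp add: algebra_simps)
  qed
  show ?thesis
    unfolding convex_in_def cube_cone_def Rn_def
    by (auto simp: vadd_def vscale_def intro!: ineq)
qed

text \<open>A closed subset of a compact box. Dropping either nonnegative term of a constraint
  bounds the other one.\<close>

lemma cube_cone_compact:
  assumes "0 < k" "0 < n" "0 < d"
  shows "compactin (prod_top n d) (cube_cone k n d)"
proof (rule closed_compactin)
  let ?Z = "\<Pi>\<^sub>E i\<in>{..<n}. {1/2 - real k..1/2 + real k}"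
  let ?X = "\<Pi>\<^sub>E j\<in>{..<d}. {-1..1::real}"
  show "compactin (prod_top n d) (?Z \<times> ?X)"
    unfolding prod_top_def by (auto simp: compactin_Times compactin_PiE)
  show "cube_cone k n d \<subseteq> ?Z \<times> ?X"
  proof (clarsimp simp: cube_cone_def)
    fix z x
    assume z: "z \<in> Rn n" and x: "x \<in> Rn d"
      and le: "\<forall>i<n. \<forall>j<d. \<bar>z i - 1/2\<bar> + real k * \<bar>x j\<bar> \<le> real k"
    have "\<bar>z i - 1/2\<bar> \<le> real k" if "i < n" for i
    proof -
      \<comment> \<open>Any index below \<open>d\<close> would do; \<open>0 < d\<close> supplies 0.
        For \<open>d = 0\<close> there are no constraints on \<open>z\<close>.\<close>
      have "\<bar>z i - 1/2\<bar> + real k * \<bar>x 0\<bar> \<le> real k"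
        using le that assms by blast
      moreover have "0 \<le> real k * \<bar>x 0\<bar>" by simp
      ultimately show ?thesis by linarith
    qed
    then have "z i \<in> {1/2 - real k..1/2 + real k}" if "i < n" for i
      using that by (auto simp: abs_le_iff algebra_simps)
    moreover have "x j \<in> {-1..1}" if "j < d" for j
    proof -
      have "\<bar>z 0 - 1/2\<bar> + real k * \<bar>x j\<bar> \<le> real k"
        using le that assms by blast
      then have "real k * \<bar>x j\<bar> \<le> real k * 1" by linarith
      then show ?thesis
        using assms(1) by (simp add: abs_le_iff)
    qed
    ultimately show "z \<in> ?Z \<and> x \<in> ?X"
      using z x by (auto simp: Rn_def PiE_def Pi_def)
  qed
  have top: "topspace (prod_top n d) = Rn n \<times> Rn d"
    by (simp add: prod_top_def Rn_def)
  have cont: "continuous_map (prod_top n d) euclideanreal (\<lambda>p. \<bar>fst p i - 1/2\<bar> + real k * \<bar>snd p j\<bar>)"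
    if "i < n" "j < d" for i j
  proof -
    have "continuous_map (prod_top n d) euclideanreal ((\<lambda>z. z i) \<circ> fst)"
      unfolding prod_top_def using that
      by (intro continuous_map_compose[OF continuous_map_fst] continuous_map_product_projection) auto
    moreover have "continuous_map (prod_top n d) euclideanreal ((\<lambda>x. x j) \<circ> snd)"
      unfolding prod_top_def using that
      by (intro continuous_map_compose[OF continuous_map_snd] continuous_map_product_projection) auto
    ultimately show ?thesis
      by (intro continuous_intros) (auto simp: o_def)
  qed
  \<comment> \<open>The index set is nonempty because \<open>n\<close> and \<open>d\<close> are
    positive; an empty intersection would be \<open>UNIV\<close> rather than the topspace.\<close>
  have "closedin (prod_top n d) (\<Inter>(i, j)\<in>{..<n} \<times> {..<d}.
      {p \<in> topspace (prod_top n d). \<bar>fst p i - 1/2\<bar> + real k * \<bar>snd p j\<bar> \<in> {..real k}})"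
    using assms
    by (intro closedin_INT) (auto simp del: atMost_iff intro!: closedin_continuous_map_preimage[OF cont])
  also have "(\<Inter>(i, j)\<in>{..<n} \<times> {..<d}.
      {p \<in> topspace (prod_top n d). \<bar>fst p i - 1/2\<bar> + real k * \<bar>snd p j\<bar> \<in> {..real k}}) =
      cube_cone k n d"
    using assms by (auto simp: cube_cone_def top)
  finally show "closedin (prod_top n d) (cube_cone k n d)" .
qed

text \<open>The open box \<open>?U\<close> grants each of the two terms of a constraint half of the
  budget \<open>k\<close>.\<close>

lemma cube_cone_interior:
  assumes "0 < k"
  shows "prod_top n d interior_of cube_cone k n d \<noteq> {}"
proof -
  let ?U = "(\<Pi>\<^sub>E i\<in>{..<n}. {1/2 - real k / 2<..<1/2 + real k / 2}) \<times>
            (\<Pi>\<^sub>E j\<in>{..<d}. {-1/2<..<1/2::real})"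
  have "openin (prod_top n d) ?U"
    unfolding prod_top_def
    by (intro iffD2[OF openin_prod_Times_iff] disjI2 conjI openin_PiE_gen[THEN iffD2]) auto
  moreover have "?U \<subseteq> cube_cone k n d"
  proof
    fix p assume "p \<in> ?U"
    then obtain z x where p: "p = (z, x)"
      and z: "z \<in> (\<Pi>\<^sub>E i\<in>{..<n}. {1/2 - real k / 2<..<1/2 + real k / 2})"
      and x: "x \<in> (\<Pi>\<^sub>E j\<in>{..<d}. {-1/2<..<1/2::real})"
      by blast
    have "\<bar>z i - 1/2\<bar> + real k * \<bar>x j\<bar> \<le> real k" if "i < n" "j < d" for i j
    proof -
      have "z i \<in> {1/2 - real k / 2<..<1/2 + real k / 2}" "x j \<in> {-1/2<..<1/2}"
        using z x that by blast+
      then have "\<bar>z i - 1/2\<bar> \<le> real k / 2" "\<bar>x j\<bar> \<le> 1/2"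
        unfolding abs_le_iff greaterThanLessThan_iff by linarith+
      moreover from this have "real k * \<bar>x j\<bar> \<le> real k * (1/2)"
        by (intro mult_left_mono) auto
      ultimately show ?thesis by linarith
    qed
    then show "p \<in> cube_cone k n d"
      using z x by (auto simp: p cube_cone_def Rn_def PiE_def)
  qed
  ultimately have "?U \<subseteq> prod_top n d interior_of cube_cone k n d"
    by (rule interior_of_maximal[rotated])
  moreover have "((\<lambda>i\<in>{..<n}. 1/2), (\<lambda>j\<in>{..<d}. 0)) \<in> ?U"
    using assms by auto
  ultimately show ?thesis by blast
qed

lemma cube_cone_convex_body:
  assumes "0 < k" "0 < n" "0 < d"
  shows "convex_body n d (cube_cone k n d)"
  using assms by (simp add: convex_body_def cube_cone_convex cube_cone_compact cube_cone_interior)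

text \<open>Over a point of the translated cube the choice \<open>x = 0\<close> leaves the whole
  budget \<open>k\<close> to the first term.\<close>

lemma cube_cone_projection:
  "(\<lambda>u. vadd n (\<lambda>i\<in>{..<n}. 1/2) (vscale n (real k) u)) ` Binf n \<subseteq> fst ` cube_cone k n d"
proof
  fix w assume "w \<in> (\<lambda>u. vadd n (\<lambda>i\<in>{..<n}. 1/2) (vscale n (real k) u)) ` Binf n"
  then obtain u where u: "u \<in> Binf n" and w: "w = vadd n (\<lambda>i\<in>{..<n}. 1/2) (vscale n (real k) u)"
    by blast
  have "\<bar>w i - 1/2\<bar> \<le> real k" if "i < n" for i
  proof -
    have "\<bar>u i\<bar> \<le> linf_norm n u"
      unfolding linf_norm_def using that by (intro Max_ge) auto
    then have "\<bar>u i\<bar> \<le> 1"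
      using u by (simp add: Binf_def)
    then have "real k * \<bar>u i\<bar> \<le> real k * 1"
      by (intro mult_left_mono) auto
    then show ?thesis
      using that by (simp add: w vadd_def vscale_def abs_mult)
  qed
  then have "(w, \<lambda>j\<in>{..<d}. 0) \<in> cube_cone k n d"
    by (auto simp: cube_cone_def Rn_def w vadd_def)
  then show "w \<in> fst ` cube_cone k n d"
    by (metis fst_conv imageI)
qed

section \<open>Lattice cubes and separating halfspaces\<close>

text \<open>For positive \<open>n\<close> these are the lattice points at sup-distance at most
  \<open>j + 1/2\<close> from the centre (1/2, ..., 1/2); \<open>lattice_cube n 0\<close> is the
  vertex set of the unit cube.\<close>

definition lattice_cube :: "nat \<Rightarrow> nat \<Rightarrow> rvec set" where
  "lattice_cube n j = (\<Pi>\<^sub>E i\<in>{..<n}. real_of_int ` {- int j..int j + 1})"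

lemma lattice_cube_finite: "finite (lattice_cube n j)"
  by (auto simp: lattice_cube_def intro!: finite_PiE)

lemma lattice_cube_card: "card (lattice_cube n j) = (2 * j + 2) ^ n"
proof -
  have "card (real_of_int ` {- int j..int j + 1}) = 2 * j + 2"
    by (subst card_image) (auto simp: inj_on_def)
  then show ?thesis
    by (simp add: lattice_cube_def card_PiE)
qed

lemma lattice_cube_subset_Zn: "lattice_cube n j \<subseteq> Zn n"
  unfolding lattice_cube_def Zn_def by (intro PiE_mono) auto

lemma lattice_cube_mono: "i \<le> j \<Longrightarrow> lattice_cube n i \<subseteq> lattice_cube n j"
  unfolding lattice_cube_def by (intro PiE_mono image_mono) auto

lemma lattice_cube_0_D: "z \<in> lattice_cube n 0 \<Longrightarrow> i < n \<Longrightarrow> z i = 0 \<or> z i = 1"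
proof -
  assume "z \<in> lattice_cube n 0" "i < n"
  then have "z i \<in> real_of_int ` {0..1}"
    unfolding lattice_cube_def by auto
  then obtain a :: int where "z i = of_int a" "0 \<le> a" "a \<le> 1" by auto
  then show ?thesis by (cases "a = 0") auto
qed

lemma outside_lattice_cube_obtain:
  assumes "z \<in> Zn n" "z \<notin> lattice_cube n j"
  obtains i where "i < n" "z i \<le> - real j - 1 \<or> real j + 2 \<le> z i"
proof -
  obtain i where i: "i < n" "z i \<notin> real_of_int ` {- int j..int j + 1}"
    using assms by (auto simp: lattice_cube_def Zn_def PiE_iff)
  moreover obtain a where a: "z i = of_int a"
    using assms(1) i(1) by (auto simp: Zn_def PiE_iff Ints_def)
  ultimately have "a \<le> - int j - 1 \<or> int j + 2 \<le> a" by auto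
  then have "z i \<le> - real j - 1 \<or> real j + 2 \<le> z i"
    unfolding a by linarith
  with i(1) show ?thesis by (rule that)
qed

text \<open>A vertex of the unit cube is the unique maximiser of a linear functional on the cube,
  and any other lattice point is separated from the cube by one coordinate. The halfspace is a
  cylinder over \<open>Rn d\<close>, so it contains the whole fibre over \<open>z\<close>.\<close>

lemma halfspace_isolating_vertex:
  assumes "z \<in> Zn n" "0 < n"
  obtains H where "closed_halfspace n d H" "{z} \<times> Rn d \<subseteq> H"
    "\<forall>(z', x)\<in>H. z' \<in> lattice_cube n 0 \<longrightarrow> z' = z"
proof -
  note obtained = that
  have zR: "z \<in> Rn n"
    using assms(1) by (auto simp: Zn_def Rn_def PiE_def)
  \<comment> \<open>It suffices to find a normal \<open>a\<close> whose functional is strictly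
    larger at \<open>z\<close> than at all other vertices; the boundary hyperplane then passes
    through \<open>z\<close>.\<close>
  have isolate: thesis if a: "a \<in> Rn n" "\<exists>i<n. a i \<noteq> 0"
    and sep: "\<And>z'. z' \<in> lattice_cube n 0 \<Longrightarrow> z' \<noteq> z \<Longrightarrow> vdot n a z' < vdot n a z" for a
  proof -
    let ?b = "\<lambda>j\<in>{..<d}. 0 :: real"
    let ?H = "{(z', x). z' \<in> Rn n \<and> x \<in> Rn d \<and> vdot n a z' + vdot d ?b x \<ge> vdot n a z}"
    have b: "vdot d ?b x = 0" for x
      by (simp add: vdot_def)
    have "?b \<in> Rn d" by (auto simp: Rn_def)
    then have "closed_halfspace n d ?H"
      unfolding closed_halfspace_def using a by blast
    moreover have "{z} \<times> Rn d \<subseteq> ?H"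
      using zR by (auto simp: b)
    moreover have "\<forall>(z', x)\<in>?H. z' \<in> lattice_cube n 0 \<longrightarrow> z' = z"
      using sep by (force simp: b)
    ultimately show thesis by (rule obtained)
  qed
  show thesis
  proof (cases "z \<in> lattice_cube n 0")
    case True
    \<comment> \<open>The entries are 1 where \<open>z i = 1\<close> and -1 where
      \<open>z i = 0\<close>, so each coordinate in which \<open>z'\<close> differs from
      \<open>z\<close> costs exactly 1.\<close>
    define a where "a = (\<lambda>i\<in>{..<n}. 2 * z i - 1)"
    show thesis
    proof (rule isolate[of a])
      show "a \<in> Rn n" by (auto simp: a_def Rn_def)
      show "\<exists>i<n. a i \<noteq> 0"
        using lattice_cube_0_D[OF True assms(2)] assms(2) by (intro exI[of _ 0]) (auto simp: a_def)
      fix z' assume z': "z' \<in> lattice_cube n 0" "z' \<noteq> z"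
      have "\<exists>i<n. z' i \<noteq> z i"
        using PiE_ext[OF z'(1)[unfolded lattice_cube_def] True[unfolded lattice_cube_def]] z'(2)
        by blast
      then obtain i where i: "i < n" "z' i \<noteq> z i" by blast
      show "vdot n a z' < vdot n a z"
        unfolding vdot_def
      proof (rule sum_strict_mono_ex1)
        show "\<forall>i\<in>{..<n}. a i * z' i \<le> a i * z i"
          using lattice_cube_0_D[OF True] lattice_cube_0_D[OF z'(1)] by (fastforce simp: a_def)
        show "\<exists>i\<in>{..<n}. a i * z' i < a i * z i"
          using lattice_cube_0_D[OF True i(1)] lattice_cube_0_D[OF z'(1) i(1)] i
          by (intro bexI[of _ i]) (auto simp: a_def)
      qed simp
    qed
  next
    case False
    then obtain i where i: "i < n" "z i \<le> - 1 \<or> 2 \<le> z i"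
      using outside_lattice_cube_obtain[OF assms(1) False] by auto
    \<comment> \<open>The sign makes the functional increase along coordinate \<open>i\<close> away
      from the unit cube, towards \<open>z\<close>.\<close>
    define a where "a = (\<lambda>l\<in>{..<n}. if l = i then sgn (z i) else 0)"
    have dot: "vdot n a v = sgn (z i) * v i" for v
    proof -
      have "vdot n a v = (\<Sum>l<n. if l = i then sgn (z i) * v i else 0)"
        unfolding vdot_def by (intro sum.cong) (auto simp: a_def)
      then show ?thesis using i(1) by simp
    qed
    show thesis
    proof (rule isolate[of a])
      show "a \<in> Rn n" by (auto simp: a_def Rn_def)
      show "\<exists>i<n. a i \<noteq> 0"
        using i by (intro exI[of _ i]) (auto simp: a_def sgn_if)
      show "vdot n a z' < vdot n a z" if "z' \<in> lattice_cube n 0" for z'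
        using i(2) lattice_cube_0_D[OF that i(1)] by (auto simp: dot sgn_if)
    qed
  qed
qed

section \<open>Fibres of the cone and their volumes\<close>

text \<open>For \<open>j < k\<close> this is the volume of the fibre over a lattice point at
  sup-distance exactly \<open>j + 1/2\<close> from the centre, a cube of half-side
  \<open>1 - (j + 1/2) / k\<close>.\<close>

definition fiber_volume :: "nat \<Rightarrow> nat \<Rightarrow> nat \<Rightarrow> real" where
  "fiber_volume k d j = (2 * (1 - (real j + 1/2) / real k)) ^ d"

definition fiber :: "nat \<Rightarrow> nat \<Rightarrow> nat \<Rightarrow> rvec \<Rightarrow> rvec set" where
  "fiber k n d z = {x \<in> Rn d. (z, x) \<in> cube_cone k n d}"

text \<open>The constraints of the single coordinate \<open>i\<close> already bound every
  \<open>x j\<close>. For \<open>s > k\<close> the intervals are empty, which later gives empty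
  fibres.\<close>

lemma fiber_subset_cube:
  assumes "i < n" "0 < k" "s \<le> \<bar>z i - 1/2\<bar>"
  shows "fiber k n d z \<subseteq> (\<Pi>\<^sub>E j\<in>{..<d}. {-(1 - s / real k)..1 - s / real k})"
proof
  fix x assume "x \<in> fiber k n d z"
  then have x: "x \<in> Rn d" "\<And>j. j < d \<Longrightarrow> \<bar>z i - 1/2\<bar> + real k * \<bar>x j\<bar> \<le> real k"
    using assms(1) by (auto simp: fiber_def cube_cone_def)
  have "x j \<in> {-(1 - s / real k)..1 - s / real k}" if "j < d" for j
  proof -
    have "\<bar>x j\<bar> \<le> (real k - s) / real k"
      using x(2)[OF that] assms by (simp add: field_simps)
    also have "\<dots> = 1 - s / real k"
      using assms(2) by (simp add: field_simps)
    finally show ?thesis by (auto simp: abs_le_iff)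
  qed
  then show "x \<in> (\<Pi>\<^sub>E j\<in>{..<d}. {-(1 - s / real k)..1 - s / real k})"
    using x(1) by (auto simp: Rn_def PiE_def Pi_def)
qed

text \<open>By integrality, leaving the cube of index \<open>j\<close> jumps to the next
  half-integer distance, hence \<open>Suc j\<close>.\<close>

lemma outside_lattice_cube_half:
  assumes "z \<in> Zn n" "z \<notin> lattice_cube n j"
  obtains i where "i < n" "real (Suc j) + 1/2 \<le> \<bar>z i - 1/2\<bar>"
proof -
  obtain i where "i < n" "z i \<le> - real j - 1 \<or> real j + 2 \<le> z i"
    using outside_lattice_cube_obtain[OF assms] .
  then show thesis
    by (intro that[of i]) (auto simp: abs_if)
qed

text \<open>Stated for subsets \<open>A\<close> so as to cover fibres cut by a halfspace;
  \<open>Suc j < k\<close> keeps the half-side of the bounding cube nonnegative.\<close>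

lemma fiber_vol_outside_le:
  assumes "z \<in> Zn n" "z \<notin> lattice_cube n j" "Suc j < k" "A \<subseteq> fiber k n d z"
  shows "vol d A \<le> ennreal (fiber_volume k d (Suc j))"
proof -
  obtain i where i: "i < n" "real (Suc j) + 1/2 \<le> \<bar>z i - 1/2\<bar>"
    using outside_lattice_cube_half[OF assms(1,2)] .
  have "real (Suc j) + 1/2 \<le> real k"
    using assms(3) by linarith
  then have "0 \<le> 1 - (real (Suc j) + 1/2) / real k"
    using assms(3) by (simp add: field_simps)
  then show ?thesis
    unfolding fiber_volume_def
    using fiber_subset_cube[OF i(1), of k "real (Suc j) + 1/2" z d] i(2) assms
    by (intro vol_le_cube) auto
qed

text \<open>Such a point has distance at least \<open>k + 1/2\<close> from the centre, so the
  bounding interval is empty; \<open>0 < d\<close> makes the product of these intervals empty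
  too.\<close>

lemma fiber_empty_outside:
  assumes "z \<in> Zn n" "z \<notin> lattice_cube n (k - 1)" "0 < k" "0 < d"
  shows "fiber k n d z = {}"
proof -
  obtain i where i: "i < n" "real (Suc (k - 1)) + 1/2 \<le> \<bar>z i - 1/2\<bar>"
    using outside_lattice_cube_half[OF assms(1,2)] .
  then have "fiber k n d z \<subseteq>
      (\<Pi>\<^sub>E j\<in>{..<d}. {-(1 - (real k + 1/2) / real k)..1 - (real k + 1/2) / real k})"
    using assms(3) by (intro fiber_subset_cube) auto
  moreover have "{-(1 - (real k + 1/2) / real k)..1 - (real k + 1/2) / real k} = {}"
    using assms(3) by (simp add: field_simps)
  ultimately show ?thesis
    using assms(4) by (auto simp: PiE_eq_empty_iff)
qed

text \<open>All coordinates of a vertex are at distance exactly 1/2 from the centre, so the bounding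
  cube is attained.\<close>

lemma fiber_vertex:
  assumes "z \<in> lattice_cube n 0" "0 < n" "0 < k"
  shows "fiber k n d z = (\<Pi>\<^sub>E j\<in>{..<d}. {-(1 - (1/2) / real k)..1 - (1/2) / real k})"
proof
  have half: "\<bar>z i - 1/2\<bar> = 1/2" if "i < n" for i
    using lattice_cube_0_D[OF assms(1) that] by auto
  show "fiber k n d z \<subseteq> (\<Pi>\<^sub>E j\<in>{..<d}. {-(1 - (1/2) / real k)..1 - (1/2) / real k})"
    using assms half by (intro fiber_subset_cube[of 0]) auto
  show "(\<Pi>\<^sub>E j\<in>{..<d}. {-(1 - (1/2) / real k)..1 - (1/2) / real k}) \<subseteq> fiber k n d z"
  proof
    fix x assume x: "x \<in> (\<Pi>\<^sub>E j\<in>{..<d}. {-(1 - (1/2) / real k)..1 - (1/2) / real k})"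
    have "1/2 + real k * \<bar>x j\<bar> \<le> real k" if "j < d" for j
    proof -
      have "x j \<in> {-(1 - (1/2) / real k)..1 - (1/2) / real k}"
        using x that by blast
      then have "\<bar>x j\<bar> \<le> 1 - (1/2) / real k"
        unfolding abs_le_iff by auto
      then show ?thesis
        using assms(3) by (simp add: field_simps)
    qed
    moreover have "z \<in> Rn n" "x \<in> Rn d"
      using assms(1) x by (auto simp: lattice_cube_def Rn_def PiE_def)
    ultimately show "x \<in> fiber k n d z"
      by (auto simp: fiber_def cube_cone_def half)
  qed
qed

lemma fiber_vol_vertex:
  assumes "z \<in> lattice_cube n 0" "0 < n" "0 < k"
  shows "vol d (fiber k n d z) = ennreal (fiber_volume k d 0)"
proof -
  have "0 \<le> 1 - (1/2) / real k"
    using assms(3) by (simp add: field_simps)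
  then show ?thesis
    using vol_cube[of "1 - (1/2) / real k" d] by (simp only: fiber_vertex[OF assms] fiber_volume_def) simp
qed

section \<open>Mixed-integer volume by shells\<close>

lemma mi_volume_cube_cone_eq_sum:
  assumes "0 < k" "0 < d" "A \<subseteq> cube_cone k n d"
  shows "mi_volume n d A = (\<Sum>z\<in>lattice_cube n (k - 1). vol d {x \<in> Rn d. (z, x) \<in> A})"
proof -
  have "mi_volume n d A = (\<Sum>\<^sub>\<infinity>z\<in>lattice_cube n (k - 1). vol d {x \<in> Rn d. (z, x) \<in> A})"
    unfolding mi_volume_def
  proof (rule infsum_cong_neutral)
    fix z assume z: "z \<in> Zn n - lattice_cube n (k - 1)"
    have "{x \<in> Rn d. (z, x) \<in> A} \<subseteq> fiber k n d z"
      using assms(3) by (auto simp: fiber_def)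
    also have "\<dots> = {}"
      using z assms by (intro fiber_empty_outside) auto
    finally have "{x \<in> Rn d. (z, x) \<in> A} = {}" by simp
    then show "vol d {x \<in> Rn d. (z, x) \<in> A} = 0"
      by (simp only: vol_def emeasure_empty)
  qed (use lattice_cube_subset_Zn in blast)+
  then show ?thesis
    by (simp add: lattice_cube_finite)
qed

text \<open>Induction on \<open>J\<close>, peeling off the shell between consecutive lattice cubes.
  The number of points in a shell is bounded crudely by that of its outer cube.\<close>

lemma sum_shells_le:
  fixes g :: "rvec \<Rightarrow> ennreal"
  assumes "\<And>j z. j < J \<Longrightarrow> z \<in> Zn n \<Longrightarrow> z \<notin> lattice_cube n j \<Longrightarrow> g z \<le> w j"
  shows "(\<Sum>z\<in>lattice_cube n J. g z) \<le>
    (\<Sum>z\<in>lattice_cube n 0. g z) + (\<Sum>j<J. of_nat ((2 * Suc j + 2) ^ n) * w j)"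
  using assms
proof (induction J)
  case (Suc J)
  let ?D = "lattice_cube n (Suc J) - lattice_cube n J"
  have "(\<Sum>z\<in>?D. g z) \<le> (\<Sum>z\<in>?D. w J)"
    using lattice_cube_subset_Zn by (intro sum_mono Suc.prems) auto
  also have "\<dots> = of_nat (card ?D) * w J" by simp
  also have "\<dots> \<le> of_nat ((2 * Suc J + 2) ^ n) * w J"
  proof (intro mult_right_mono)
    have "card ?D \<le> card (lattice_cube n (Suc J))"
      by (intro card_mono lattice_cube_finite) auto
    then show "of_nat (card ?D) \<le> (of_nat ((2 * Suc J + 2) ^ n) :: ennreal)"
      unfolding lattice_cube_card by (rule of_nat_mono)
  qed simp
  finally have D: "(\<Sum>z\<in>?D. g z) \<le> of_nat ((2 * Suc J + 2) ^ n) * w J" .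
  have IH: "(\<Sum>z\<in>lattice_cube n J. g z) \<le>
      (\<Sum>z\<in>lattice_cube n 0. g z) + (\<Sum>j<J. of_nat ((2 * Suc j + 2) ^ n) * w j)"
    by (rule Suc.IH) (use Suc.prems in simp)
  have "(\<Sum>z\<in>lattice_cube n (Suc J). g z) = (\<Sum>z\<in>?D. g z) + (\<Sum>z\<in>lattice_cube n J. g z)"
    by (intro sum.subset_diff lattice_cube_mono lattice_cube_finite) simp
  also have "\<dots> \<le> of_nat ((2 * Suc J + 2) ^ n) * w J +
      ((\<Sum>z\<in>lattice_cube n 0. g z) + (\<Sum>j<J. of_nat ((2 * Suc j + 2) ^ n) * w j))"
    by (intro add_mono D IH)
  finally show ?case by (simp add: ac_simps)
qed simp

text \<open>The fibre volume decays at least like \<open>exp (- \<alpha> * j * n)\<close>, while the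
  count \<open>(2 * j + 2) ^ n\<close> grows at most like \<open>2 ^ n * (2 ^ j) ^ n\<close>. The
  shells are thus dominated by a geometric sequence whose initial value is the total volume over the
  vertices.\<close>

lemma shell_volume_le:
  assumes "j < k" "0 \<le> \<alpha>" "\<alpha> * real k * real n \<le> real d"
  shows "(2 * real j + 2) ^ n * fiber_volume k d j \<le>
    2 ^ n * fiber_volume k d 0 * ((2 * exp (- \<alpha>)) ^ n) ^ j"
proof -
  define s where "s = 1 - (1/2) / real k"
  have k: "real k \<ge> 1" "real j + 1/2 \<le> real k"
    using assms(1) by linarith+
  have s: "0 < s"
    using k(1) by (simp add: s_def field_simps)
  \<comment> \<open>Factoring out the half-side \<open>s\<close> of a vertex fibre costs only a
    nonnegative product term; then \<open>1 - t \<le> exp (- t)\<close> applies with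
    \<open>t = j / k\<close>.\<close>
  have "s * (1 - real j / real k) - (1 - (real j + 1/2) / real k) = (real j / real k) * (1/2 / real k)"
    using k by (simp add: s_def field_simps)
  moreover have "0 \<le> (real j / real k) * (1/2 / real k)" by simp
  ultimately have "1 - (real j + 1/2) / real k \<le> s * (1 - real j / real k)"
    by linarith
  also have "\<dots> \<le> s * exp (- (real j / real k))"
    using s exp_ge_add_one_self[of "- (real j / real k)"] by (intro mult_left_mono) auto
  finally have "2 * (1 - (real j + 1/2) / real k) \<le> 2 * s * exp (- (real j / real k))"
    by (simp only: mult.assoc mult_le_cancel_left_pos[OF zero_less_numeral])
  moreover have "0 \<le> 2 * (1 - (real j + 1/2) / real k)"
    using k by (simp add: field_simps)
  ultimately have "fiber_volume k d j \<le> (2 * s * exp (- (real j / real k))) ^ d"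
    unfolding fiber_volume_def by (rule power_mono)
  also have "\<dots> = fiber_volume k d 0 * exp (- (real j / real k)) ^ d"
    by (simp add: fiber_volume_def s_def power_mult_distrib)
  also have "exp (- (real j / real k)) ^ d = exp (- (real j * (real d / real k)))"
    by (simp add: exp_of_nat_mult[symmetric])
  also have "fiber_volume k d 0 * \<dots> \<le> fiber_volume k d 0 * exp (- (real j * (\<alpha> * real n)))"
  proof (intro mult_left_mono iffD2[OF exp_le_cancel_iff] le_imp_neg_le)
    show "\<alpha> * real n \<le> real d / real k"
      using assms(3) k by (simp add: field_simps)
    show "0 \<le> fiber_volume k d 0"
      using s by (simp add: fiber_volume_def s_def)
  qed simp
  also have "exp (- (real j * (\<alpha> * real n))) = (exp (- \<alpha>) ^ j) ^ n"
    by (simp add: exp_of_nat_mult[symmetric] algebra_simps)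
  finally have 1: "fiber_volume k d j \<le> fiber_volume k d 0 * (exp (- \<alpha>) ^ j) ^ n" .
  \<comment> \<open>This bound, tight at \<open>j = 0\<close> and \<open>j = 1\<close>, turns the
    ratio into \<open>2 * exp (- \<alpha>)\<close>, which is below 1 exactly when
    \<open>\<alpha> > ln 2\<close>.\<close>
  have "real j + 1 \<le> 2 ^ j"
    by (induction j) auto
  then have 2: "(2 * real j + 2) ^ n \<le> (2 * 2 ^ j) ^ n"
    by (intro power_mono) auto
  have "(2 * real j + 2) ^ n * fiber_volume k d j \<le>
      (2 * 2 ^ j) ^ n * (fiber_volume k d 0 * (exp (- \<alpha>) ^ j) ^ n)"
    using \<open>0 \<le> 2 * (1 - _)\<close> by (intro mult_mono 1 2) (auto simp: fiber_volume_def)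
  also have "\<dots> = 2 ^ n * fiber_volume k d 0 * ((2 * exp (- \<alpha>)) ^ n) ^ j"
    by (simp add: power_mult_distrib power_mult[symmetric] mult.commute)
  finally show ?thesis .
qed

text \<open>Replacing \<open>(q ^ n) ^ j\<close> by \<open>q ^ j\<close> after extracting one factor
  \<open>q ^ n\<close> makes the constant \<open>1 / (1 - q)\<close> independent of
  \<open>n\<close>.\<close>

lemma sum_geometric_power_le:
  fixes q :: real
  assumes "0 \<le> q" "q < 1" "0 < n"
  shows "(\<Sum>j<J. (q ^ n) ^ Suc j) \<le> q ^ n / (1 - q)"
proof -
  have qn: "q ^ n \<le> q"
    using assms power_decreasing[of 1 n q] by simp
  have "(\<Sum>j<J. (q ^ n) ^ Suc j) \<le> (\<Sum>j<J. q ^ n * q ^ j)"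
    using assms qn by (intro sum_mono) (auto intro!: mult_left_mono power_mono)
  also have "\<dots> = q ^ n * (\<Sum>j<J. q ^ j)"
    by (simp add: sum_distrib_left)
  also have "\<dots> \<le> q ^ n * (\<Sum>j. q ^ j)"
    using assms by (intro mult_left_mono sum_le_suminf summable_geometric) auto
  also have "\<dots> = q ^ n / (1 - q)"
    using assms by (simp add: suminf_geometric)
  finally show ?thesis .
qed

lemma inverse_antimono_ennreal:
  fixes a b :: ennreal
  shows "a \<le> b \<Longrightarrow> inverse b \<le> inverse a"
  by (simp add: less_eq_ennreal.rep_eq inverse_ennreal.rep_eq ereal_inverse_antimono)

section \<open>The depth bound\<close>

text \<open>With \<open>v\<close> the volume of a vertex fibre, \<open>S\<close> has volume at least
  \<open>2 ^ n * v\<close>, while the isolating halfspace at \<open>y\<close> captures at most one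
  vertex fibre plus the shells. The quotient gives the two summands.\<close>

lemma cube_cone_depth_le:
  fixes \<alpha> :: real
  assumes "0 < n" "0 < d" "0 < k" "ln 2 < \<alpha>" "\<alpha> * real k * real n \<le> real d"
    and S: "S = cube_cone k n d \<inter> (Zn n \<times> Rn d)" and "y \<in> S"
  shows "halfspace_depth n d S y / mi_volume n d S \<le>
    ennreal ((1/2) ^ n + (2 * exp (- \<alpha>)) ^ n / (1 - 2 * exp (- \<alpha>)))"
proof -
  define q where "q = 2 * exp (- \<alpha>)"
  define v where "v = fiber_volume k d 0"
  obtain z x where y: "y = (z, x)" by (cases y)
  have z: "z \<in> Zn n" and x: "x \<in> Rn d"
    using \<open>y \<in> S\<close> by (auto simp: S y)
  have "2 < exp \<alpha>"
    using assms(4) exp_less_mono[of "ln 2" \<alpha>] by simp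
  then have q: "0 < q" "q < 1"
    by (auto simp: q_def exp_minus field_simps)
  have "0 < 1 - (1/2) / real k"
    using assms(3) by (simp add: field_simps)
  then have v: "0 < v"
    by (simp add: v_def fiber_volume_def)
  obtain H where H: "closed_halfspace n d H" "{z} \<times> Rn d \<subseteq> H"
    "\<forall>(z', x)\<in>H. z' \<in> lattice_cube n 0 \<longrightarrow> z' = z"
    using halfspace_isolating_vertex[where d = d, OF z assms(1)] .
  have S_fiber: "{x \<in> Rn d. (z', x) \<in> S} = fiber k n d z'" if "z' \<in> Zn n" for z'
    using that by (auto simp: S fiber_def)

  \<comment> \<open>Lower bound on the denominator: only the fibres over the vertices are
    counted.\<close>
  have "ennreal (2 ^ n * v) = (\<Sum>z\<in>lattice_cube n 0. ennreal v)"
    by (simp add: lattice_cube_card ennreal_mult'' v[THEN less_imp_le] ennreal_power[symmetric] ennreal_numeral)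
  also have "\<dots> = (\<Sum>z\<in>lattice_cube n 0. vol d {x \<in> Rn d. (z, x) \<in> S})"
  proof (rule sum.cong[OF refl])
    fix z' assume z': "z' \<in> lattice_cube n 0"
    show "ennreal v = vol d {x \<in> Rn d. (z', x) \<in> S}"
      using fiber_vol_vertex[OF z' assms(1,3)] S_fiber[of z'] z' lattice_cube_subset_Zn[of n 0]
      by (auto simp: v_def)
  qed
  also have "\<dots> \<le> (\<Sum>z\<in>lattice_cube n (k - 1). vol d {x \<in> Rn d. (z, x) \<in> S})"
    by (intro sum_mono2 lattice_cube_finite lattice_cube_mono) auto
  also have "\<dots> = mi_volume n d S"
    using assms by (intro mi_volume_cube_cone_eq_sum[symmetric]) auto
  finally have lower: "ennreal (2 ^ n * v) \<le> mi_volume n d S" .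

  let ?g = "\<lambda>z. vol d {x \<in> Rn d. (z, x) \<in> S \<inter> H}"
  have "mi_volume n d (S \<inter> H) = (\<Sum>z\<in>lattice_cube n (k - 1). ?g z)"
    using assms by (intro mi_volume_cube_cone_eq_sum) auto
  also have "\<dots> \<le> (\<Sum>z\<in>lattice_cube n 0. ?g z) +
      (\<Sum>j<k - 1. of_nat ((2 * Suc j + 2) ^ n) * ennreal (fiber_volume k d (Suc j)))"
  proof (rule sum_shells_le)
    fix j z' assume "j < k - 1" "z' \<in> Zn n" "z' \<notin> lattice_cube n j"
    then show "?g z' \<le> ennreal (fiber_volume k d (Suc j))"
      by (intro fiber_vol_outside_le[of z' n j k]) (auto simp: S fiber_def)
  qed
  also have "\<dots> \<le> ennreal v + (\<Sum>j<k - 1. ennreal (2 ^ n * v * (q ^ n) ^ Suc j))"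
  proof (intro add_mono sum_mono)
    \<comment> \<open>Among the vertices only \<open>z\<close> itself can have a nonempty slice in
      \<open>H\<close>; if \<open>z\<close> is not a vertex, the right-hand sum is 0.\<close>
    have "(\<Sum>z'\<in>lattice_cube n 0. ?g z') \<le> (\<Sum>z'\<in>lattice_cube n 0. if z' = z then ennreal v else 0)"
    proof (intro sum_mono)
      fix z' assume z': "z' \<in> lattice_cube n 0"
      show "?g z' \<le> (if z' = z then ennreal v else 0)"
      proof (cases "z' = z")
        case True
        have "{x \<in> Rn d. (z', x) \<in> S \<inter> H} = fiber k n d z'"
          using z H(2) True by (auto simp: S fiber_def)
        then show ?thesis
          using True fiber_vol_vertex[OF z'] assms by (simp add: v_def)
      next
        case False
        then have "{x \<in> Rn d. (z', x) \<in> S \<inter> H} = {}"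
          using H(3) z' by auto
        then show ?thesis by (simp only: vol_def emeasure_empty) simp
      qed
    qed
    also have "\<dots> \<le> ennreal v"
      by (simp add: lattice_cube_finite)
    finally show "(\<Sum>z'\<in>lattice_cube n 0. ?g z') \<le> ennreal v" .
  next
    fix j assume "j \<in> {..<k - 1}"
    then have "(2 * real (Suc j) + 2) ^ n * fiber_volume k d (Suc j) \<le> 2 ^ n * v * (q ^ n) ^ Suc j"
      unfolding v_def q_def using assms(5) order.strict_trans[OF ln_gt_zero assms(4)]
      by (intro shell_volume_le) auto
    moreover have "of_nat ((2 * Suc j + 2) ^ n) * ennreal (fiber_volume k d (Suc j)) =
        ennreal ((2 * real (Suc j) + 2) ^ n * fiber_volume k d (Suc j))"
      by (subst ennreal_mult') (auto simp: ennreal_of_nat_eq_real_of_nat)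
    ultimately show "of_nat ((2 * Suc j + 2) ^ n) * ennreal (fiber_volume k d (Suc j)) \<le>
        ennreal (2 ^ n * v * (q ^ n) ^ Suc j)"
      by (simp add: ennreal_leI)
  qed
  also have "\<dots> = ennreal (v + 2 ^ n * v * (\<Sum>j<k - 1. (q ^ n) ^ Suc j))"
    using v q by (simp add: sum_ennreal ennreal_plus sum_nonneg sum_distrib_left)
  also have "\<dots> \<le> ennreal (v + 2 ^ n * v * (q ^ n / (1 - q)))"
    using v q assms(1)
    by (intro ennreal_leI add_left_mono mult_left_mono sum_geometric_power_le) auto
  finally have upper: "mi_volume n d (S \<inter> H) \<le> ennreal (v + 2 ^ n * v * (q ^ n / (1 - q)))" .

  have "halfspace_depth n d S y \<le> mi_volume n d (S \<inter> H)"
    unfolding halfspace_depth_def using H(1,2) x by (intro INF_lower) (auto simp: y)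
  then have "halfspace_depth n d S y / mi_volume n d S \<le>
      ennreal (v + 2 ^ n * v * (q ^ n / (1 - q))) / ennreal (2 ^ n * v)"
    using upper lower unfolding divide_ennreal_def
    by (intro mult_mono inverse_antimono_ennreal) auto
  also have "\<dots> = ennreal ((v + 2 ^ n * v * (q ^ n / (1 - q))) / (2 ^ n * v))"
    using v q by (intro divide_ennreal) auto
  also have "(v + 2 ^ n * v * (q ^ n / (1 - q))) / (2 ^ n * v) = (1/2) ^ n + q ^ n / (1 - q)"
    using v by (simp add: add_divide_distrib power_one_over)
  finally show ?thesis by (simp add: q_def)
qed

section \<open>Choice of constants and dimensions\<close>

theorem theorem5p1:
  fixes \<alpha> :: real
  assumes "\<alpha> > ln 2"
  shows "\<exists>\<gamma>>0. \<exists>M>0. \<forall>k m :: nat. k \<ge> 2 \<longrightarrow> real m \<ge> 2 * (1 + \<alpha> * real k) \<longrightarrow>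
    (\<exists>n d C. n \<ge> 1 \<and> d \<ge> 1 \<and> n + d = m \<and> convex_body n d C \<and>
       (\<exists>t\<in>Rn n. (\<lambda>u. vadd n t (vscale n (real k) u)) ` Binf n \<subseteq> fst ` C) \<and>
       (let S = C \<inter> (Zn n \<times> Rn d) in
          (SUP y\<in>S. halfspace_depth n d S y / mi_volume n d S)
            \<le> ennreal (M * exp (- \<gamma> * (real m / real k)))))"
proof -
  define q where "q = 2 * exp (- \<alpha>)"
  \<comment> \<open>A common base for the two exponentials in the depth bound; \<open>M\<close>
    collects their coefficients, and its factor \<open>1 / p\<close> pays for rounding
    \<open>r\<close> down to \<open>n\<close>.\<close>
  define p where "p = max (1/2) q"
  define \<gamma> where "\<gamma> = - ln p / (1/2 + \<alpha>)"
  define M where "M = (1 + 1 / (1 - q)) / p"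
  have \<alpha>: "0 < \<alpha>"
    using assms ln_gt_zero[of "2::real"] by linarith
  have "2 < exp \<alpha>"
    using assms exp_less_mono[of "ln 2" \<alpha>] by simp
  then have q: "0 < q" "q < 1"
    by (auto simp: q_def exp_minus field_simps)
  then have p: "0 < p" "p < 1" "1/2 \<le> p" "q \<le> p"
    by (auto simp: p_def)
  have "0 < \<gamma>"
    unfolding \<gamma>_def using \<alpha> p by (intro divide_pos_pos) auto
  moreover have "0 < M"
    unfolding M_def using p q by (intro divide_pos_pos add_pos_pos) auto
  moreover have "\<exists>n d C. n \<ge> 1 \<and> d \<ge> 1 \<and> n + d = m \<and> convex_body n d C \<and>
       (\<exists>t\<in>Rn n. (\<lambda>u. vadd n t (vscale n (real k) u)) ` Binf n \<subseteq> fst ` C) \<and>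
       (let S = C \<inter> (Zn n \<times> Rn d) in
          (SUP y\<in>S. halfspace_depth n d S y / mi_volume n d S)
            \<le> ennreal (M * exp (- \<gamma> * (real m / real k))))"
    if k: "k \<ge> 2" and m: "real m \<ge> 2 * (1 + \<alpha> * real k)" for k m :: nat
  proof -
    \<comment> \<open>The real solution of \<open>r + \<alpha> * k * r = m\<close>. Its floor
      \<open>n\<close> is the largest integer with \<open>\<alpha> * k * n \<le> m - n\<close>, and
      the hypothesis on \<open>m\<close> gives \<open>r \<ge> 2\<close>, hence
      \<open>n \<ge> 1\<close>.\<close>
    define r where "r = real m / (1 + \<alpha> * real k)"
    define n where "n = nat \<lfloor>r\<rfloor>"
    define d where "d = m - n"
    have pos: "0 < 1 + \<alpha> * real k"
      using \<alpha> by (simp add: add_pos_nonneg)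
    have "2 \<le> r"
      using m pos by (simp add: r_def field_simps)
    then have n: "1 \<le> n" "real n \<le> r" "r < real n + 1"
      unfolding n_def by linarith+
    have nm: "real n + \<alpha> * real k * real n \<le> real m"
      using n(2) pos by (simp add: r_def field_simps)
    have "0 < \<alpha> * real k * real n"
      using \<alpha> k n(1) by simp
    then have d: "1 \<le> d" "n + d = m" "\<alpha> * real k * real n \<le> real d"
      using nm by (auto simp: d_def of_nat_diff)
    let ?C = "cube_cone k n d"
    let ?S = "?C \<inter> (Zn n \<times> Rn d)"
    \<comment> \<open>Here \<open>k \<ge> 2\<close> enters as \<open>1 \<le> k / 2\<close>; this is
      the source of \<open>1/2 + \<alpha>\<close> in \<open>\<gamma>\<close>.\<close>
    have "real m / real k / (1/2 + \<alpha>) \<le> r"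
    proof -
      have "1 + \<alpha> * real k \<le> real k * (1/2 + \<alpha>)"
        using k by (simp add: algebra_simps)
      then show ?thesis
        unfolding r_def divide_divide_eq_left using pos by (intro divide_left_mono) auto
    qed
    then have "real m / real k / (1/2 + \<alpha>) * (- ln p) \<le> (real n + 1) * (- ln p)"
      using n(3) p by (intro mult_right_mono) auto
    then have "real n * ln p \<le> - \<gamma> * (real m / real k) - ln p"
      by (simp add: \<gamma>_def algebra_simps)
    then have "exp (real n * ln p) \<le> exp (- \<gamma> * (real m / real k) - ln p)"
      by simp
    then have pn: "p ^ n \<le> exp (- \<gamma> * (real m / real k)) / p"
      using p(1) by (simp add: exp_of_nat_mult exp_diff)
    have "(1/2) ^ n + q ^ n / (1 - q) \<le> p ^ n + p ^ n / (1 - q)"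
      using p q by (intro add_mono divide_right_mono power_mono) auto
    also have "\<dots> = (1 + 1 / (1 - q)) * p ^ n"
      by (simp add: algebra_simps)
    also have "\<dots> \<le> (1 + 1 / (1 - q)) * (exp (- \<gamma> * (real m / real k)) / p)"
      using q pn by (intro mult_left_mono) auto
    finally have bound: "(1/2) ^ n + q ^ n / (1 - q) \<le> M * exp (- \<gamma> * (real m / real k))"
      by (simp add: M_def)
    have "(SUP y\<in>?S. halfspace_depth n d ?S y / mi_volume n d ?S)
        \<le> ennreal ((1/2) ^ n + q ^ n / (1 - q))"
      unfolding q_def using n(1) d k assms by (intro SUP_least cube_cone_depth_le) auto
    also have "\<dots> \<le> ennreal (M * exp (- \<gamma> * (real m / real k)))"
      by (rule ennreal_leI[OF bound])
    finally have depth: "(SUP y\<in>?S. halfspace_depth n d ?S y / mi_volume n d ?S)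
        \<le> ennreal (M * exp (- \<gamma> * (real m / real k)))" .
    have "convex_body n d ?C"
      using k n(1) d(1) by (intro cube_cone_convex_body) auto
    moreover have "(\<lambda>i\<in>{..<n}. 1/2) \<in> Rn n"
      by (auto simp: Rn_def)
    ultimately show ?thesis
      using n(1) d(1,2) depth cube_cone_projection[of n k d] unfolding Let_def by blast
  qed
  ultimately show ?thesis by blast
qed

end
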